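(* Let $\mathcal{O}$ be the set of all sequences $\mathbf{c}\in\{0,1\}^{\infty}$ such that $\mathbf{c}=\sigma_0(\mathbf{c})$ for some substitution $\sigma_0$ of constant length $p\geq 2$ of the form $\sigma_0(1)=v_0v_1\cdots v_{p-1}$, $\sigma_0(0)=w_0w_1\cdots w_{p-1}$ with $v_0=1$ and $v_i,w_i\in\{0,1\}$. Then the only ($0$-$1$) apwenian sequence in $\mathcal{O}$ is the period-doubling sequence, i.e. the fixed point starting with $1$ of the substitution $1\mapsto 10$, $0\mapsto 11$.
   Context: For an integer sequence $\mathbf{a}$, $H_n(\mathbf{a})=\det(a_{i+j})_{0\leq i,j\leq n-1}$. A sequence $\mathbf{c}\in\{0,1\}^{\infty}$ is ($0$-$1$) apwenian if $H_n(\mathbf{c})\equiv 1\pmod 2$ for all $n\geq 1$. Substitutions act on infinite words by concatenation of images of letters. *)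

theory Defs
  imports "Jordan_Normal_Form.Determinant" "HOL-Library.Stream" "HOL-Number_Theory.Cong"
begin

definition hankel_det :: "int stream \<Rightarrow> nat \<Rightarrow> int" where
  "hankel_det a n = det (mat n n (\<lambda>(i, j). a !! (i + j)))"

definition apwenian :: "int stream \<Rightarrow> bool" where
  "apwenian c \<longleftrightarrow> c \<in> streams {0, 1} \<and> (\<forall>n\<ge>1. [hankel_det c n = 1] (mod 2))"

text \<open>Letters are the integers 0 and 1. A substitution is given by the images of the letters;
  its values at all other integers are irrelevant, as it is only applied to words over
  \<open>{0, 1}\<close>. The function \<^const>\<open>flat\<close> is concatenation provided that
  all the images are nonempty, which holds for constant length \<open>p \<ge> 2\<close>.\<close>

definition subst_word :: "(int \<Rightarrow> int list) \<Rightarrow> int stream \<Rightarrow> int stream" where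
  "subst_word \<sigma> c = flat (smap \<sigma> c)"

definition const_length_subst :: "nat \<Rightarrow> (int \<Rightarrow> int list) \<Rightarrow> bool" where
  "const_length_subst p \<sigma> \<longleftrightarrow> (\<forall>a\<in>{0, 1}. length (\<sigma> a) = p \<and> set (\<sigma> a) \<subseteq> {0, 1})"

definition subst_fixed_points :: "int stream set" where
  "subst_fixed_points = {c \<in> streams {0, 1}.
     \<exists>p \<sigma>. p \<ge> 2 \<and> const_length_subst p \<sigma> \<and> \<sigma> 1 ! 0 = 1 \<and> c = subst_word \<sigma> c}"

definition period_doubling_subst :: "int \<Rightarrow> int list" where
  "period_doubling_subst a = (if a = 1 then [1, 0] else [1, 1])"

definition period_doubling :: "int stream" where
  "period_doubling = (THE c. c \<in> streams {0, 1} \<and> shd c = 1 \<and>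
     c = subst_word period_doubling_subst c)"

lemma subst_word_period_doubling_snth:
  "subst_word period_doubling_subst c !! n =
    (if even n then 1 else if c !! (n div 2) = 1 then 0 else 1)"
proof (induction n arbitrary: c rule: less_induct)
  case (less n)
  have unf: "subst_word period_doubling_subst c =
      1 ## (if shd c = 1 then 0 else 1) ## subst_word period_doubling_subst (stl c)"
    unfolding subst_word_def
    by (subst flat_unfold) (auto simp: period_doubling_subst_def)
  consider "n = 0" | "n = 1" | m where "n = Suc (Suc m)"
    by (metis One_nat_def not0_implies_Suc)
  then show ?case
  proof cases
    case 3
    then show ?thesis
      using less.IH[of m "stl c"] by (subst unf) simp
  qed (subst unf; simp)+
qed

text \<open>The definite description in the definition of \<^const>\<open>period_doubling\<close> is proper.\<close>

lemma period_doubling_ex1: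
  "\<exists>!c. c \<in> streams {0, 1} \<and> shd c = 1 \<and> c = subst_word period_doubling_subst c"
proof -
  define S where "S = subst_word period_doubling_subst"
  define c where "c = smap (\<lambda>n. (S ^^ Suc n) (sconst 0) !! n) nats"
  have S: "S d !! n = (if even n then 1 else if d !! (n div 2) = 1 then 0 else 1)" for d n
    unfolding S_def by (rule subst_word_period_doubling_snth)
  have stable: "(S ^^ Suc k) d !! n = (S ^^ Suc l) e !! n" if "n \<le> k" "n \<le> l" for k l n d e
    using that
  proof (induction n arbitrary: k l rule: less_induct)
    case (less n)
    show ?case
    proof (cases "even n")
      case False
      then have "0 < n" by (cases n) auto
      then obtain k' l' where "k = Suc k'" "l = Suc l'"
        using less.prems by (metis Suc_le_D gr0_conv_Suc)
      moreover have "n div 2 \<le> n - 1" "n div 2 < n"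
        using \<open>0 < n\<close> by linarith+
      ultimately have "(S ^^ k) d !! (n div 2) = (S ^^ l) e !! (n div 2)"
        using less.IH[of "n div 2" k' l'] less.prems by simp
      then show ?thesis by (simp add: S)
    qed (simp add: S)
  qed
  have stream_eqI: "d = e" if "\<And>n. d !! n = e !! n" for d e :: "int stream"
    using that by (metis ext stream_smap_nats)
  have fix_c: "c = S c"
  proof (rule stream_eqI)
    fix n
    show "c !! n = S c !! n"
    proof (cases "even n")
      case False
      then obtain m where m: "n = Suc m" "n div 2 \<le> m" by (cases n) auto
      have "(S ^^ n) (sconst 0) !! (n div 2) = c !! (n div 2)"
        using stable[of "n div 2" m "n div 2" "sconst 0" "sconst 0"] m(2)
        unfolding c_def m(1) by simp
      with False show ?thesis by (simp add: S c_def)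
    qed (simp add: S c_def)
  qed
  have ex: "c \<in> streams {0, 1}" "shd c = 1"
  proof -
    have "c !! n \<in> {0, 1}" for n
      by (subst fix_c) (simp add: S)
    then show "c \<in> streams {0, 1}" by (simp add: streams_iff_snth)
    have "c !! 0 = 1" by (subst fix_c) (simp only: S, simp)
    then show "shd c = 1" by simp
  qed
  have uniq: "d = e" if d: "d = S d" and e: "e = S e" for d e
  proof -
    have "d !! n = e !! n" for n
    proof (induction n rule: less_induct)
      case (less n)
      show ?case
      proof (cases "even n")
        case False
        then have "n div 2 < n" by (cases n) auto
        with less.IH show ?thesis by (subst d, subst e) (simp add: S)
      next
        case True
        then show ?thesis by (subst d, subst e) (simp add: S)
      qed
    qed
    then show ?thesis by (rule stream_eqI)
  qed
  show ?thesis
    using ex fix_c uniq unfolding S_def by blast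
qed

end

theory Submission imports Defs "HOL-Library.Z2" begin

text \<open>
  Over the field with two elements, all Hankel determinants of \<open>b\<close> are \<open>1\<close> if and only if
  \<open>b 0 = 1\<close> and \<open>b n = b (2n+1) + b (2n+2)\<close> for all \<open>n\<close>. Given the recurrence, a kernel vector
  \<open>(q, u)\<close> of a Hankel matrix satisfies \<open>p = p q + q\<close> for \<open>p = \<Sum> u j b j\<close>, because
  squaring is additive in characteristic two; hence \<open>q = p = 0\<close> and \<open>u\<close> is a kernel
  vector of the next smaller matrix. Conversely, \<open>b (2n)\<close> is determined by the earlier terms and the
  \<open>(n+1)\<close>-st determinant, as its coefficient there is the \<open>n\<close>-th determinant.

  Let \<open>b\<close> be also a fixed point of a substitution of length \<open>p\<close>. If the images of the letters
  start differently, then \<open>b (pn) = b n\<close>, and comparing with the recurrence at \<open>pn\<close>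
  contradicts \<open>b 0 = 1\<close>. Otherwise \<open>b (pn) = 1\<close>, so the recurrence at \<open>pn + p - 1\<close>, which relates the
  last letters of blocks \<open>n\<close> and \<open>2n+1\<close>, forces \<open>b (2n+1) \<noteq> b n\<close> and hence \<open>b (2n+2) = 1\<close>.
\<close>

text \<open>Sums and products of bits stay in ring notation, where the algebraic laws apply.\<close>

declare add_bit_eq_xor [simp del] mult_bit_eq_and [simp del]

lemma bit_add_self: "x + x = (0::bit)"
  by (cases x) simp_all

lemma bit_add_eq_0_iff: "x + y = 0 \<longleftrightarrow> x = (y::bit)"
  by (cases x; cases y) simp_all

lemma bit_mult_self: "x * x = (x::bit)"
  by (cases x) simp_all

text \<open>Off-diagonal terms come in equal pairs, which cancel in characteristic two.\<close>

lemma sum_symmetric_bit: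
  fixes g :: "nat \<Rightarrow> nat \<Rightarrow> bit"
  assumes "\<And>i j. g i j = g j i"
  shows "(\<Sum>i<n. \<Sum>j<n. g i j) = (\<Sum>i<n. g i i)"
proof (induction n)
  case (Suc n)
  have "(\<Sum>i<Suc n. \<Sum>j<Suc n. g i j) =
      (\<Sum>i<n. \<Sum>j<n. g i j) + g n n + ((\<Sum>i<n. g i n) + (\<Sum>j<n. g n j))"
    by (simp add: sum.distrib ac_simps)
  also have "(\<Sum>i<n. g i n) = (\<Sum>j<n. g n j)"
    by (rule sum.cong[OF refl]) (rule assms)
  finally show ?case
    using Suc.IH by (simp add: bit_add_self)
qed simp

section \<open>Hankel determinants over the two-element field\<close>

definition hankel_mat :: "(nat \<Rightarrow> 'a) \<Rightarrow> nat \<Rightarrow> 'a mat" where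
  "hankel_mat b n = mat n n (\<lambda>(i, j). b (i + j))"

lemma hankel_mat_carrier [simp]: "hankel_mat b n \<in> carrier_mat n n"
  by (simp add: hankel_mat_def)

text \<open>The bound \<open>k + 1 < n\<close> keeps \<open>2 * k + 2\<close> within the indices of
  the matrix of order \<open>n\<close>. This allows a use where the recurrence is known only up to
  that point.\<close>

lemma hankel_kernel_trivial:
  fixes b v :: "nat \<Rightarrow> bit"
  assumes b0: "b 0 = 1"
    and rec: "\<And>k. k + 1 < n \<Longrightarrow> b k = b (2 * k + 1) + b (2 * k + 2)"
    and ker: "\<And>i. i < n \<Longrightarrow> (\<Sum>j<n. v j * b (i + j)) = 0"
    and "j < n"
  shows "v j = 0"
  using rec ker \<open>j < n\<close>
proof (induction n arbitrary: v j)
  case (Suc n)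
  define q u p where "q = v 0" and "u = (\<lambda>j. v (Suc j))" and "p = (\<Sum>j<n. u j * b j)"
  have row: "(\<Sum>j<n. u j * b (i + j + 1)) = q * b i" if "i \<le> n" for i
  proof -
    have "(\<Sum>j<Suc n. v j * b (i + j)) = 0"
      using Suc.prems(2)[of i] that by simp
    then have "q * b i + (\<Sum>j<n. u j * b (i + j + 1)) = 0"
      by (simp add: sum.lessThan_Suc_shift q_def u_def del: sum.lessThan_Suc)
    then show ?thesis
      by (simp add: bit_add_eq_0_iff)
  qed
  \<comment> \<open>As \<open>u i * u i = u i\<close>, the recurrence makes \<open>p\<close> the
    diagonal of a symmetric double sum.\<close>
  have "p = (\<Sum>i<n. u i * u i * (b (i + i + 1) + b (i + i + 2)))"
    unfolding p_def
  proof (rule sum.cong[OF refl])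
    fix i assume "i \<in> {..<n}"
    then have "b i = b (2 * i + 1) + b (2 * i + 2)"
      by (intro Suc.prems(1)) simp
    then show "u i * b i = u i * u i * (b (i + i + 1) + b (i + i + 2))"
      by (simp add: bit_mult_self mult_2)
  qed
  also have "\<dots> = (\<Sum>i<n. \<Sum>j<n. u i * u j * (b (i + j + 1) + b (i + j + 2)))"
    by (rule sum_symmetric_bit[symmetric]) (simp add: ac_simps)
  also have "\<dots> = (\<Sum>i<n. u i * ((\<Sum>j<n. u j * b (i + j + 1)) + (\<Sum>j<n. u j * b (Suc i + j + 1))))"
    by (simp add: sum_distrib_left sum.distrib algebra_simps)
  also have "\<dots> = (\<Sum>i<n. u i * (q * b i + q * b (Suc i)))"
    by (rule sum.cong[OF refl]) (simp only: row lessThan_iff Suc_leI less_imp_le)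
  also have "\<dots> = q * (p + (\<Sum>j<n. u j * b (0 + j + 1)))"
    by (simp add: p_def sum_distrib_left sum.distrib algebra_simps)
  also have "\<dots> = q * (p + q)"
    by (simp only: row le0 b0 mult_1_right)
  finally have "p = q * (p + q)" .
  \<comment> \<open>If \<open>q = 1\<close>, the equation reads \<open>p = p + 1\<close>; so
    \<open>q = 0\<close>, and then \<open>p = 0\<close>.\<close>
  then have q: "q = 0" and p: "p = 0"
    by (cases p; cases q; simp)+
  have "u k = 0" if "k < n" for k
  proof (rule Suc.IH)
    show "(\<Sum>j<n. u j * b (i + j)) = 0" if "i < n" for i
    proof (cases i)
      case 0
      then show ?thesis using p by (simp add: p_def)
    next
      case (Suc i')
      then show ?thesis using row[of i'] that q by simp
    qed
  qed (use that Suc.prems(1) in auto)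
  then show ?case
    using q Suc.prems(3) by (cases j) (auto simp: q_def u_def)
qed simp

lemma det_hankel_mat_bit:
  fixes b :: "nat \<Rightarrow> bit"
  assumes "b 0 = 1" "\<And>k. k + 1 < n \<Longrightarrow> b k = b (2 * k + 1) + b (2 * k + 2)"
  shows "det (hankel_mat b n) = 1"
proof (rule ccontr)
  assume "det (hankel_mat b n) \<noteq> 1"
  then have "det (hankel_mat b n) = 0" by simp
  then obtain v where v: "v \<in> carrier_vec n" "v \<noteq> 0\<^sub>v n" "hankel_mat b n *\<^sub>v v = 0\<^sub>v n"
    using det_0_iff_vec_prod_zero_field[OF hankel_mat_carrier] by blast
  have "(\<Sum>j<n. v $ j * b (i + j)) = 0" if "i < n" for i
  proof -
    have "(hankel_mat b n *\<^sub>v v) $ i = (\<Sum>j<n. v $ j * b (i + j))"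
      using that v(1) by (simp add: hankel_mat_def scalar_prod_def lessThan_atLeast0 mult.commute)
    then show ?thesis using v(3) that by simp
  qed
  with assms have "v $ j = 0" if "j < n" for j
    using that hankel_kernel_trivial[of b n "($) v"] by blast
  then have "v = 0\<^sub>v n"
    using v(1) by (intro eq_vecI) auto
  with v(2) show False ..
qed

text \<open>Expand along the last row: its cofactors involve only indices below
  \<open>2 * n\<close>, so they agree, and the two rows differ only in the corner, whose cofactor is
  the determinant of order \<open>n\<close>.\<close>

lemma det_hankel_mat_change_last:
  fixes b b' :: "nat \<Rightarrow> 'a :: comm_ring_1"
  assumes eq: "\<And>k. k < 2 * n \<Longrightarrow> b k = b' k"
  shows "det (hankel_mat b (Suc n)) - det (hankel_mat b' (Suc n)) =
    (b (2 * n) - b' (2 * n)) * det (hankel_mat b n)"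
proof -
  let ?A = "hankel_mat b (Suc n)" and ?B = "hankel_mat b' (Suc n)"
  have cof: "cofactor ?A n j = cofactor ?B n j" if "j \<le> n" for j
  proof -
    have "mat_delete ?A n j = mat_delete ?B n j"
      using that by (intro eq_matI) (auto simp: mat_delete_def hankel_mat_def intro!: eq)
    then show ?thesis by (simp add: cofactor_def)
  qed
  have last: "cofactor ?A n n = det (hankel_mat b n)"
  proof -
    have "mat_delete ?A n n = hankel_mat b n"
      by (intro eq_matI) (auto simp: mat_delete_def hankel_mat_def)
    then show ?thesis by (simp add: cofactor_def)
  qed
  have row: "?A $$ (n, j) = b (n + j)" "?B $$ (n, j) = b' (n + j)" if "j \<le> n" for j
    using that by (simp_all add: hankel_mat_def)
  have "det ?A - det ?B = (\<Sum>j<Suc n. (b (n + j) - b' (n + j)) * cofactor ?A n j)"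
    unfolding laplace_expansion_row[OF hankel_mat_carrier lessI] sum_subtractf[symmetric]
    by (rule sum.cong[OF refl]) (simp add: row cof left_diff_distrib)
  also have "\<dots> = (b (2 * n) - b' (2 * n)) * cofactor ?A n n"
    by (simp add: eq mult_2)
  finally show ?thesis unfolding last .
qed

lemma hankel_recurrence:
  fixes b :: "nat \<Rightarrow> bit"
  assumes det1: "\<And>n. n \<ge> 1 \<Longrightarrow> det (hankel_mat b n) = 1"
  shows "b 0 = 1" and "b n = b (2 * n + 1) + b (2 * n + 2)"
proof -
  show b0: "b 0 = 1"
    using det1[of 1] by (simp add: hankel_mat_def det_single)
  show "b n = b (2 * n + 1) + b (2 * n + 2)"
  proof (induction n rule: less_induct)
    case (less n)
    \<comment> \<open>\<open>b'\<close> takes at \<open>2 * n + 2\<close> the value that the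
      recurrence demands, so its determinant of order \<open>n + 2\<close> is 1 as well.\<close>
    define b' where "b' = b(2 * Suc n := b n + b (2 * n + 1))"
    have "det (hankel_mat b' (Suc (Suc n))) = 1"
    proof (rule det_hankel_mat_bit)
      fix k assume "k + 1 < Suc (Suc n)"
      then show "b' k = b' (2 * k + 1) + b' (2 * k + 2)"
        using less.IH[of k]
        by (cases "k = n") (auto simp: b'_def ac_simps bit_add_self simp flip: add.assoc)
    qed (simp add: b'_def b0)
    then have "0 = (b (2 * Suc n) - b' (2 * Suc n)) * det (hankel_mat b (Suc n))"
      using det_hankel_mat_change_last[of "Suc n" b b'] det1[of "Suc (Suc n)"]
      by (simp add: b'_def)
    then have "b (2 * Suc n) = b n + b (2 * n + 1)"
      using det1[of "Suc n"] by (simp add: b'_def bit_add_eq_0_iff)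
    then show ?case
      by (cases "b n"; cases "b (2 * n + 1)") simp_all
  qed
qed

section \<open>Fixed points of constant-length substitutions\<close>

lemma block_sequence_period_doubling:
  fixes b :: "nat \<Rightarrow> bit" and g :: "nat \<Rightarrow> bit \<Rightarrow> bit"
  assumes p: "p \<ge> 2"
    and block: "\<And>n i. i < p \<Longrightarrow> b (p * n + i) = g i (b n)"
    and b0: "b 0 = 1"
    and rec: "\<And>n. b n = b (2 * n + 1) + b (2 * n + 2)"
  shows "b (2 * n + 1) = b n + 1" and "b (2 * n + 2) = 1"
proof -
  have g01: "g 0 1 = 1"
    using block[of 0 0] p b0 by simp
  have b12: "b 1 \<noteq> b 2"
    using rec[of 0] b0 by (auto simp: bit_add_self numeral_2_eq_2)
  have "g 0 0 = 1"
  proof (rule ccontr)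
    assume "g 0 0 \<noteq> 1"
    then have g0: "g 0 x = x" for x
      using g01 by (cases x) simp_all
    have bp: "b (p * m) = b m" for m
      using block[of 0 m] p g0 by simp
    have "p \<noteq> 2"
      using bp[of 1] b12 by auto
    then have "p > 2" using p by simp
    \<comment> \<open>Positions \<open>2 * p * m + 1\<close> and \<open>2 * p * m + 2\<close> lie in
      block \<open>2 * m\<close>, since \<open>p > 2\<close>.\<close>
    define h where "h x = g 1 x + g 2 x" for x
    have bh: "b m = h (b (2 * m))" for m
    proof -
      have "b m = b (2 * (p * m) + 1) + b (2 * (p * m) + 2)"
        using bp[of m] rec[of "p * m"] by simp
      also have "\<dots> = h (b (2 * m))"
        using block[of 1 "2 * m"] block[of 2 "2 * m"] \<open>p > 2\<close>
        by (simp add: h_def mult.left_commute)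
      finally show ?thesis .
    qed
    have "h 1 = 1"
      using bh[of 0] b0 by simp
    show False
    \<comment> \<open>With \<open>h 1 = 1\<close>, \<open>h\<close> is the identity or constantly 1;
      either way \<open>b 1 = b 2\<close>.\<close>
    proof (cases "h 0 = 0")
      case True
      then have "h x = x" for x
        using \<open>h 1 = 1\<close> by (cases x) simp_all
      then show False
        using bh[of 1] b12 by simp
    next
      case False
      then have "h x = 1" for x
        using \<open>h 1 = 1\<close> by (cases x) simp_all
      then show False
        using bh[of 1] bh[of 2] b12 by metis
    qed
  qed
  then have "g 0 x = 1" for x
    using g01 by (cases x) simp_all
  then have bp: "b (p * m) = 1" for m
    using block[of 0 m] p by simp
  \<comment> \<open>The recurrence at the last letter of block \<open>n\<close> meets the last
    letter of block \<open>2 * n + 1\<close> and the first of block \<open>2 * n + 2\<close>, which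
    is 1.\<close>
  have "2 * (p * n + (p - 1)) + 1 = p * (2 * n + 1) + (p - 1)"
    "2 * (p * n + (p - 1)) + 2 = p * (2 * n + 2)"
    using p by (simp_all add: algebra_simps)
  then have "g (p - 1) (b n) = g (p - 1) (b (2 * n + 1)) + 1"
    using rec[of "p * n + (p - 1)"] block[of "p - 1" n] block[of "p - 1" "2 * n + 1"] p
      bp[of "2 * n + 2"] by simp
  then have "b n \<noteq> b (2 * n + 1)"
    by (cases "g (p - 1) (b n)") auto
  then show *: "b (2 * n + 1) = b n + 1"
    by (cases "b n"; cases "b (2 * n + 1)") simp_all
  show "b (2 * n + 2) = 1"
    using rec[of n] unfolding * by (cases "b n"; cases "b (2 * n + 2)") simp_all
qed

section \<open>Streams of integers and their reductions modulo 2\<close>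

lemma subst_word_snth:
  assumes "const_length_subst p \<sigma>" "c \<in> streams {0, 1}" "i < p"
  shows "subst_word \<sigma> c !! (p * n + i) = \<sigma> (c !! n) ! i"
proof -
  have len: "length (\<sigma> (shd d)) = p" if "d \<in> streams {0, 1}" for d
    using assms(1) streams_shd[OF that] unfolding const_length_subst_def by blast
  \<comment> \<open>\<open>i < p\<close> makes the images nonempty, so that \<open>flat\<close>
    unfolds.\<close>
  have unf: "subst_word \<sigma> d = \<sigma> (shd d) @- subst_word \<sigma> (stl d)" if "d \<in> streams {0, 1}" for d
    using len[OF that] assms(3) unfolding subst_word_def by (subst flat_unfold) auto
  from assms(2) show ?thesis
  proof (induction n arbitrary: c)
    case 0
    then show ?case
      using len assms(3) by (simp add: unf shift_snth_less)
  next
    case (Suc n)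
    then show ?case
      using len Suc.IH[OF streams_stl[OF Suc.prems]] by (simp add: unf shift_snth_ge)
  qed
qed

lemma of_int_bit_eq_1_iff: "(of_int x :: bit) = 1 \<longleftrightarrow> odd x"
proof -
  have "(of_int (x div 2 * 2 + x mod 2) :: bit) = of_int (x mod 2)"
    by (simp only: of_int_add of_int_mult) simp
  then have "(of_int x :: bit) = of_int (x mod 2)"
    by (simp only: div_mult_mod_eq)
  then show ?thesis
    by (cases "even x") (auto simp: even_iff_mod_2_eq_zero odd_iff_mod_2_eq_one)
qed

text \<open>The determinant commutes with the ring homomorphism from the integers to
  \<open>bit\<close>.\<close>

lemma apwenian_iff_det_bit:
  "apwenian c \<longleftrightarrow> c \<in> streams {0, 1} \<and>
    (\<forall>n\<ge>1. det (hankel_mat (\<lambda>k. of_int (c !! k) :: bit) n) = 1)"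
proof -
  have "det (hankel_mat (\<lambda>k. of_int (c !! k) :: bit) n) = of_int (hankel_det c n)" for n
  proof -
    have "hankel_mat (\<lambda>k. of_int (c !! k) :: bit) n = map_mat of_int (hankel_mat (snth c) n)"
      by (intro eq_matI) (auto simp: hankel_mat_def)
    then show ?thesis
      by (simp add: hankel_det_def hankel_mat_def)
  qed
  then show ?thesis
    by (simp add: apwenian_def of_int_bit_eq_1_iff cong_def odd_iff_mod_2_eq_one)
qed

lemma stream_eqI: "(\<And>n. s !! n = t !! n) \<Longrightarrow> s = t"
  by (metis ext stream_smap_nats)

lemma period_doubling_fixed_point:
  "period_doubling \<in> streams {0, 1}" "shd period_doubling = 1"
  "subst_word period_doubling_subst period_doubling = period_doubling"
  using theI'[OF period_doubling_ex1] unfolding period_doubling_def[symmetric] by auto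

lemma period_doubling_in_subst_fixed_points: "period_doubling \<in> subst_fixed_points"
proof -
  have "const_length_subst 2 period_doubling_subst" "period_doubling_subst 1 ! 0 = 1"
    by (simp_all add: const_length_subst_def period_doubling_subst_def)
  then show ?thesis
    using period_doubling_fixed_point unfolding subst_fixed_points_def
    by (auto intro!: exI[of _ 2] exI[of _ period_doubling_subst])
qed

lemma apwenian_period_doubling: "apwenian period_doubling"
proof -
  define b :: "nat \<Rightarrow> bit" where "b = (\<lambda>k. of_int (period_doubling !! k))"
  have snth: "period_doubling !! n =
      (if even n then 1 else if period_doubling !! (n div 2) = 1 then 0 else 1)" for n
    by (subst period_doubling_fixed_point(3)[symmetric]) (rule subst_word_period_doubling_snth)
  have val: "period_doubling !! n \<in> {0, 1}" for n
    using snth[of n] by auto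
  have "b 0 = 1"
    using snth[of 0] by (simp add: b_def)
  moreover have "b k = b (2 * k + 1) + b (2 * k + 2)" for k
    using val[of k] snth[of "2 * k + 1"] snth[of "2 * k + 2"]
    by (auto simp: b_def simp del: snth.simps)
  ultimately have "det (hankel_mat b n) = 1" for n
    by (intro det_hankel_mat_bit)
  then show ?thesis
    using period_doubling_fixed_point(1) by (simp add: apwenian_iff_det_bit b_def)
qed

lemma apwenian_fixed_point_eq_period_doubling:
  assumes "c \<in> subst_fixed_points" "apwenian c"
  shows "c = period_doubling"
proof -
  obtain p \<sigma> where p: "p \<ge> 2" and len: "const_length_subst p \<sigma>"
    and fp: "c = subst_word \<sigma> c" and c01: "c \<in> streams {0, 1}"
    using assms(1) unfolding subst_fixed_points_def by blast
  have val: "c !! n = 0 \<or> c !! n = 1" for n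
    using c01 by (auto simp: streams_iff_snth)
  define b :: "nat \<Rightarrow> bit" where "b = (\<lambda>k. of_int (c !! k))"
  \<comment> \<open>The conditional lifts a bit back to the letter it came from.\<close>
  define g :: "nat \<Rightarrow> bit \<Rightarrow> bit" where "g i x = of_int (\<sigma> (if x = 1 then 1 else 0) ! i)" for i x
  have "det (hankel_mat b n) = 1" if "n \<ge> 1" for n
    using assms(2) that by (simp add: apwenian_iff_det_bit b_def)
  note rec = hankel_recurrence[OF this]
  have "b (p * n + i) = g i (b n)" if "i < p" for n i
    using subst_word_snth[OF len c01 that, of n] val[of n] unfolding fp[symmetric]
    by (auto simp: b_def g_def)
  note pd = block_sequence_period_doubling[OF p this rec]
  have even: "c !! (2 * n) = 1" for n
  proof (cases n)
    case 0
    then show ?thesis using rec(1) val[of 0] by (auto simp: b_def)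
  next
    case (Suc m)
    then show ?thesis using pd(2)[of m] val[of "2 * m + 2"] by (auto simp: b_def)
  qed
  have odd: "c !! (2 * n + 1) = (if c !! n = 1 then 0 else 1)" for n
    using pd(1)[of n] val[of n] val[of "2 * n + 1"] by (auto simp: b_def)
  have "c = subst_word period_doubling_subst c"
  proof (rule stream_eqI)
    show "c !! n = subst_word period_doubling_subst c !! n" for n
      using even[of "n div 2"] odd[of "n div 2"]
      by (cases "even n") (simp_all add: subst_word_period_doubling_snth)
  qed
  moreover have "shd c = 1"
    using even[of 0] by simp
  ultimately show ?thesis
    using c01 period_doubling_ex1 period_doubling_fixed_point by metis
qed

theorem theorem1p6:
  "{c \<in> subst_fixed_points. apwenian c} = {period_doubling}"
  using apwenian_fixed_point_eq_period_doubling period_doubling_in_subst_fixed_points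
    apwenian_period_doubling by blast

end
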